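(* For all integers $m,n\ge1$ and every function $\Psi:\mathbb{Z}^n\to\mathbb{R}_{>0}$, each of the three sets $\mathcal{A}_{n,m}(\Psi)$, $\mathcal{A}'_{n,m}(\Psi)$ and $\mathcal{A}''_{n,m}(\Psi)$ has $nm$-dimensional Lebesgue measure equal to $0$ or $1$.
   Context: Let $m,n\ge1$ be integers. Points $\mathbf{X}\in[0,1]^{nm}$ are regarded as real $n\times m$ matrices, $\mathbf{q}\in\mathbb{Z}^n$ as a row vector, so $\mathbf{q}\mathbf{X}\in\mathbb{R}^m$; $|\cdot|$ denotes the supremum norm on $\mathbb{R}^m$. For $\Psi:\mathbb{Z}^n\to\mathbb{R}_{>0}$ consider the inequality ( * ) $|\mathbf{q}\mathbf{X}+\mathbf{p}|<\Psi(\mathbf{q})$, with $\mathbf{p}=(p_1,\dots,p_m)\in\mathbb{Z}^m$, $\mathbf{q}\in\mathbb{Z}^n\setminus\{\mathbf{0}\}$. $\mathcal{A}_{n,m}(\Psi)$ is the set of $\mathbf{X}\in[0,1]^{nm}$ for which ( * ) holds for infinitely many pairs $(\mathbf{p},\mathbf{q})$; $\mathcal{A}'_{n,m}(\Psi)$ is the set of $\mathbf{X}\in[0,1]^{nm}$ for which ( * ) holds for infinitely many $(\mathbf{p},\mathbf{q})$ with $\gcd(\mathbf{p},\mathbf{q})=1$ (the gcd of all components of $\mathbf{p}$ and $\mathbf{q}$); $\mathcal{A}''_{n,m}(\Psi)$ is the set of $\mathbf{X}\in[0,1]^{nm}$ for which ( * ) holds for infinitely many $(\mathbf{p},\mathbf{q})$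 with $\gcd(p_j,\mathbf{q})=1$ for every $j=1,\dots,m$ (gcd of $p_j$ and all components of $\mathbf{q}$). *)

theory Defs
  imports "HOL-Analysis.Analysis"
begin

text \<open>Points X of [0,1]^{nm} are n x m real matrices, represented as real^'m^'n
 (rows indexed by 'n, columns by 'm). The dimensions n, m are the cardinalities
 of the finite index types 'n, 'm.\<close>

definition unit_cube :: "(real^'m^'n) set" where
  "unit_cube = {X. \<forall>i j. 0 \<le> X$i$j \<and> X$i$j \<le> 1}"

definition qXp :: "int^'n \<Rightarrow> real^'m^'n \<Rightarrow> int^'m \<Rightarrow> real^'m" where
  "qXp q X p = ((\<chi> i. real_of_int (q$i)) v* X) + (\<chi> j. real_of_int (p$j))"

definition approx_ineq :: "(int^'n \<Rightarrow> real) \<Rightarrow> real^'m^'n \<Rightarrow> int^'m \<Rightarrow> int^'n \<Rightarrow> bool" where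
  "approx_ineq \<Psi> X p q \<longleftrightarrow> q \<noteq> 0 \<and> (\<forall>j. \<bar>qXp q X p $ j\<bar> < \<Psi> q)"

definition A_set :: "(int^'n \<Rightarrow> real) \<Rightarrow> (real^'m^'n) set" where
  "A_set \<Psi> = {X \<in> unit_cube. infinite {(p, q). approx_ineq \<Psi> X p q}}"

definition A'_set :: "(int^'n \<Rightarrow> real) \<Rightarrow> (real^'m^'n) set" where
  "A'_set \<Psi> = {X \<in> unit_cube. infinite {(p, q). approx_ineq \<Psi> X p q
        \<and> Gcd (range (\<lambda>j. p$j) \<union> range (\<lambda>i. q$i)) = 1}}"

definition A''_set :: "(int^'n \<Rightarrow> real) \<Rightarrow> (real^'m^'n) set" where
  "A''_set \<Psi> = {X \<in> unit_cube. infinite {(p, q). approx_ineq \<Psi> X p q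
        \<and> (\<forall>j. Gcd (insert (p$j) (range (\<lambda>i. q$i))) = 1)}}"

definition zero_one_law :: "(real^'m^'n) set \<Rightarrow> bool" where
  "zero_one_law S \<longleftrightarrow> S \<in> sets lebesgue \<and> (emeasure lebesgue S = 0 \<or> emeasure lebesgue S = 1)"

end

theory Submission
  imports Defs "HOL-Computational_Algebra.Primes"
begin

text \<open>
  Gallagher's argument, carried out directly for matrices. Fix a prime l and split the vectors q
  into those not divisible by l, those divisible by l with some entry not divisible by l^2, and
  those divisible by l^2. Up to replacing \<open>\<Psi>\<close> by a constant multiple, the
  first two kinds of limsup sets are mapped into themselves by the expanding maps X -> l X and
  X -> l X + C, where C has one row equal to (1/l, ..., 1/l) and zeros elsewhere; such a constant
  does not change the measure (Cassels), so by Lebesgue density each of these sets is null or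
  co-null. The third kind is invariant under translation by integer matrices divided by l. If all
  sets of the first two kinds are null for every l, the whole limsup set is invariant modulo null
  sets under a dense set of translations, hence null or co-null.
\<close>

section \<open>Density points and zero-one laws\<close>

text \<open>Enclose \<open>S\<close> in an open \<open>G\<close> with \<open>G - S\<close> of
  measure below \<open>e * \<eta>\<close>. Vitali covering yields disjoint bad balls inside
  \<open>G\<close> that contain almost all bad points. Each has at least the fraction
  \<open>e\<close> of its volume in \<open>G - S\<close>, so their total volume is at most
  \<open>\<eta>\<close>.\<close>

lemma lebesgue_density_negligible:
  fixes S :: "'a::euclidean_space set"
  assumes S: "S \<in> sets lebesgue" and e: "e > 0"
  shows "negligible {x \<in> S. \<forall>d>0. \<exists>r. 0 < r \<and> r < d \<and>
           e * measure lebesgue (ball x r) \<le> measure lebesgue (ball x r - S)}" (is "negligible ?T")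
  unfolding negligible_outer_le
proof (intro allI impI)
  fix \<eta> :: real assume \<eta>: "\<eta> > 0"
  let ?\<mu> = "measure lebesgue :: 'a set \<Rightarrow> real"
  obtain G where G: "open G" "S \<subseteq> G" "(G - S) \<in> lmeasurable" "emeasure lebesgue (G - S) < ennreal (e * \<eta>)"
    using sets_lebesgue_outer_open[OF S, of "e * \<eta>"] e \<eta> by auto
  have mG: "?\<mu> (G - S) \<le> e * \<eta>"
    unfolding measure_def using G(4) e \<eta> by (intro enn2real_leI) auto
  define K :: "('a \<times> real) set" where "K = {(x, r). 0 < r \<and> ball x r \<subseteq> G \<and> e * ?\<mu> (ball x r) \<le> ?\<mu> (ball x r - S)}"
  obtain C :: "('a \<times> real) set" where C: "countable C" "C \<subseteq> K"
    and pw: "pairwise (\<lambda>i j. disjnt (ball (fst i) (snd i)) (ball (fst j) (snd j))) C"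
    and neg: "negligible (?T - (\<Union>i\<in>C. ball (fst i) (snd i)))"
  proof (rule Vitali_covering_theorem_balls [of ?T K fst snd])
    fix x and d :: real assume x: "x \<in> ?T" and d: "0 < d"
    have "x \<in> S" using x by simp
    with G(2) obtain k where k: "k > 0" "ball x k \<subseteq> G"
      using openE[OF G(1), of x] by blast
    from x have *: "\<And>d. d>0 \<Longrightarrow> \<exists>r. 0 < r \<and> r < d \<and> e * ?\<mu> (ball x r) \<le> ?\<mu> (ball x r - S)"
      using CollectD[OF x] by simp
    obtain r where r: "0 < r" "r < min d k" "e * ?\<mu> (ball x r) \<le> ?\<mu> (ball x r - S)"
      using *[of "min d k"] d k(1) by (metis min_less_iff_conj)
    have "ball x r \<subseteq> G" using r(2) k(2) subset_ball[of r k x] by auto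
    then show "\<exists>i. i \<in> K \<and> x \<in> ball (fst i) (snd i) \<and> snd i < d"
      using r unfolding K_def by (intro exI[of _ "(x, r)"]) auto
  qed (rule that)
  let ?B = "\<lambda>i. ball (fst i) (snd i) :: 'a set"
  have bound: "?\<mu> (\<Union>i\<in>I. ?B i) \<le> \<eta>" if I: "I \<subseteq> C" "finite I" for I
  proof -
    have pwI: "pairwise (\<lambda>i j. disjnt (?B i) (?B j)) I"
      using pw I(1) pairwise_subset by blast
    then have pwI': "pairwise (\<lambda>i j. disjnt (?B i - S) (?B j - S)) I"
      by (rule pairwise_mono) (auto simp: disjnt_def)
    have meas: "?B i - S \<in> lmeasurable" for i
      using S by (simp add: fmeasurable_Diff)
    have "e * ?\<mu> (\<Union>i\<in>I. ?B i) = (\<Sum>i\<in>I. e * ?\<mu> (?B i))"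
      using measure_UNION'[of I ?B lebesgue] I(2) pwI by (simp add: sum_distrib_left)
    also have "\<dots> \<le> (\<Sum>i\<in>I. ?\<mu> (?B i - S))"
      using I(1) C(2) unfolding K_def by (intro sum_mono) auto
    also have "\<dots> = ?\<mu> (\<Union>i\<in>I. ?B i - S)"
      using measure_UNION'[of I "\<lambda>i. ?B i - S" lebesgue] I(2) pwI' meas by simp
    also have "\<dots> \<le> ?\<mu> (G - S)"
    proof (rule measure_mono_fmeasurable[OF _ _ G(3)])
      have "?B i \<subseteq> G" if "i \<in> I" for i
        using subsetD[OF subset_trans[OF I(1) C(2)] that] by (auto simp: K_def case_prod_unfold)
      then show "(\<Union>i\<in>I. ?B i - S) \<subseteq> G - S" by blast
      show "(\<Union>i\<in>I. ?B i - S) \<in> sets lebesgue"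
        using I(2) meas by (intro sets.finite_UN) (auto simp: fmeasurableD)
    qed
    finally have "e * ?\<mu> (\<Union>i\<in>I. ?B i) \<le> e * \<eta>" using mG by linarith
    then show ?thesis using e by simp
  qed
  \<comment> \<open>The bound over finite subfamilies passes to the whole countable family.\<close>
  have U: "(\<Union>i\<in>C. ?B i) \<in> lmeasurable" "?\<mu> (\<Union>i\<in>C. ?B i) \<le> \<eta>"
    using \<eta> bound by (auto intro!: fmeasurable_UN_bound[OF C(1)] measure_UN_bound[OF C(1)])
  show "\<exists>V. ?T \<subseteq> V \<and> V \<in> lmeasurable \<and> ?\<mu> V \<le> \<eta>"
  proof (intro exI conjI)
    let ?V = "(?T - (\<Union>i\<in>C. ?B i)) \<union> (\<Union>i\<in>C. ?B i)"
    show "?T \<subseteq> ?V" by blast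
    show "?V \<in> lmeasurable" using neg U(1) by (intro fmeasurable.Un) (auto simp: negligible_imp_measurable)
    have "?\<mu> ?V = ?\<mu> (\<Union>i\<in>C. ?B i)"
      by (rule measure_negligible_symdiff[OF U(1)]) (rule negligible_subset[OF neg], blast)
    then show "?\<mu> ?V \<le> \<eta>" using U(2) by simp
  qed
qed

text \<open>The exceptional sets for \<open>e = 1/(n+1)\<close> are null, hence so is their union; a
  non-null \<open>S\<close> has a point outside all of them.\<close>

lemma lebesgue_density_point:
  fixes S :: "'a::euclidean_space set"
  assumes S: "S \<in> sets lebesgue" and nn: "\<not> negligible S"
  obtains x where "x \<in> S"
    "\<And>e. e > 0 \<Longrightarrow> \<exists>d>0. \<forall>r. 0 < r \<longrightarrow> r < d \<longrightarrow>
        measure lebesgue (ball x r - S) < e * measure lebesgue (ball x r)"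
proof -
  define T where "T e = {x \<in> S. \<forall>d>0. \<exists>r. 0 < r \<and> r < d \<and>
           e * measure lebesgue (ball x r) \<le> measure lebesgue (ball x r - S)}" for e :: real
  have "negligible (T (inverse (Suc n)))" for n
    unfolding T_def by (rule lebesgue_density_negligible[OF S]) simp
  then have "negligible (\<Union>n. T (inverse (Suc n)))" by (intro negligible_countable_Union) auto
  with nn have "\<not> S \<subseteq> (\<Union>n. T (inverse (Suc n)))" using negligible_subset by blast
  then obtain x where x: "x \<in> S" "\<And>n. x \<notin> T (inverse (Suc n))" by auto
  show thesis
  proof (rule that[OF x(1)])
    fix e :: real assume "e > 0"
    then obtain n where n: "inverse (Suc n) < e" using reals_Archimedean by blast
    have "x \<in> S" "x \<notin> T (inverse (Suc n))" using x by blast+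
    then obtain d where d: "d > 0" "\<And>r. 0 < r \<Longrightarrow> r < d \<Longrightarrow>
        measure lebesgue (ball x r - S) < inverse (Suc n) * measure lebesgue (ball x r)"
      unfolding T_def mem_Collect_eq by (metis not_less)
    have "measure lebesgue (ball x r - S) < e * measure lebesgue (ball x r)" if "0 < r" "r < d" for r
    proof -
      have "inverse (Suc n) * measure lebesgue (ball x r) \<le> e * measure lebesgue (ball x r)"
        using n by (intro mult_right_mono) auto
      with d(2)[OF that] show ?thesis by linarith
    qed
    then show "\<exists>d>0. \<forall>r. 0 < r \<longrightarrow> r < d \<longrightarrow>
        measure lebesgue (ball x r - S) < e * measure lebesgue (ball x r)"
      using d(1) by blast
  qed
qed

lemma negligible_iff_bounded_parts:
  fixes S :: "'a::euclidean_space set"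
  shows "negligible S \<longleftrightarrow> (\<forall>R>0. negligible (S \<inter> ball 0 R))"
proof
  assume *: "\<forall>R>0. negligible (S \<inter> ball 0 R)"
  have "S \<subseteq> (\<Union>n::nat. S \<inter> ball 0 (Suc n))"
  proof
    fix x assume "x \<in> S"
    obtain n :: nat where "norm x < n" using reals_Archimedean2 by blast
    then show "x \<in> (\<Union>n::nat. S \<inter> ball 0 (Suc n))" using \<open>x \<in> S\<close> by (auto intro!: exI[of _ n])
  qed
  moreover have "negligible (\<Union>n::nat. S \<inter> ball 0 (Suc n))"
    using * by (intro negligible_countable_Union) auto
  ultimately show "negligible S" using negligible_subset by blast
qed (auto intro: negligible_Int)

lemma lmeasurable_affinity:
  fixes S :: "'a::euclidean_space set"
  assumes S: "S \<in> lmeasurable" and m: "m \<noteq> 0"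
  shows "(\<lambda>x. m *\<^sub>R x + c) ` S \<in> lmeasurable"
proof (rule fmeasurableI)
  have "(*\<^sub>R) m ` S = (*\<^sub>R) (1 / m) -` S \<inter> space lebesgue"
    using m by (auto simp: image_iff intro!: bexI[of _ "(1 / m) *\<^sub>R _"])
  also have "\<dots> \<in> sets lebesgue"
    using S by (intro measurable_sets[OF lebesgue_measurable_scaling]) auto
  finally have "(+) c ` ((*\<^sub>R) m ` S) \<in> sets lebesgue"
    by (rule lebesgue_sets_translation)
  then show "(\<lambda>x. m *\<^sub>R x + c) ` S \<in> sets lebesgue"
    by (simp add: image_image add.commute)
  show "emeasure lebesgue ((\<lambda>x. m *\<^sub>R x + c) ` S) < \<infinity>"
    using fmeasurableD2[OF S] by (simp add: emeasure_lebesgue_affine ennreal_mult_less_top less_top)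
qed

section \<open>Zero-one criteria from expanding maps and from dense translations\<close>

text \<open>A tiny ball about a density point of \<open>U\<close> is almost filled by
  \<open>U\<close>. Iterates of the expanding map blow it up to a fixed radius while sending
  \<open>U\<close> into \<open>U\<close>, and periodicity moves the result over any prescribed ball
  about 0; hence \<open>- U\<close> has arbitrarily small measure there.\<close>

lemma negligible_or_compl_of_expanding:
  fixes U :: "'a::euclidean_space set"
  assumes U: "U \<in> sets lebesgue" and N: "N > (1::real)"
    and expand: "\<And>x. x \<in> U \<Longrightarrow> N *\<^sub>R x + c \<in> U"
    and period: "\<And>x z. z \<in> L \<Longrightarrow> x \<in> U \<longleftrightarrow> x + z \<in> U"
    and lattice: "\<And>x. \<exists>z\<in>L. dist x z \<le> K"
  shows "negligible U \<or> negligible (- U)"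
proof (rule disjCI)
  assume "\<not> negligible (- U)"
  show "negligible U"
  proof (rule ccontr)
    assume "\<not> negligible U"
    then obtain x where dens: "\<And>e. e > 0 \<Longrightarrow> \<exists>d>0. \<forall>r. 0 < r \<longrightarrow> r < d \<longrightarrow>
        measure lebesgue (ball x r - U) < e * measure lebesgue (ball x r)"
      using lebesgue_density_point[OF U] by metis
    have iter: "\<exists>b. \<forall>x\<in>U. (N ^ s) *\<^sub>R x + b \<in> U" for s
    proof (induction s)
      case 0
      then show ?case by (intro exI[of _ 0]) simp
    next
      case (Suc s)
      then obtain b where b: "\<forall>x\<in>U. (N ^ s) *\<^sub>R x + b \<in> U" by blast
      have "(N ^ Suc s) *\<^sub>R x + (N *\<^sub>R b + c) \<in> U" if "x \<in> U" for x
        using expand[of "(N ^ s) *\<^sub>R x + b"] b that by (simp add: algebra_simps)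
      then show ?case by blast
    qed
    have "negligible (- U \<inter> ball 0 R)" if R: "R > 0" for R
      unfolding negligible_outer_le
    proof (intro allI impI)
      fix \<eta> :: real assume \<eta>: "\<eta> > 0"
      \<comment> \<open>The image of \<open>x\<close> lies within \<open>K\<close> of a period
        \<open>z\<close>, so radius \<open>K + R\<close> about that image reaches every point of
        \<open>ball z R\<close>.\<close>
      define \<rho> where "\<rho> = \<bar>K\<bar> + R"
      have \<rho>: "\<rho> > 0" using R unfolding \<rho>_def by simp
      define V where "V = measure lebesgue (ball (0::'a) \<rho>)"
      have V: "V > 0" unfolding V_def using \<rho> by simp
      obtain d where d: "d > 0" "\<And>r. 0 < r \<Longrightarrow> r < d \<Longrightarrow>
        measure lebesgue (ball x r - U) < (\<eta> / V) * measure lebesgue (ball x r)"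
        using dens[of "\<eta> / V"] \<eta> V by auto
      obtain s where s: "\<rho> / d < N ^ s" using real_arch_pow[OF N] by blast
      define M where "M = N ^ s"
      have M: "M > 0" "\<rho> / M < d" using s d(1) N \<rho> unfolding M_def by (auto simp: field_simps)
      obtain b where b: "\<And>x. x \<in> U \<Longrightarrow> M *\<^sub>R x + b \<in> U" using iter[of s] unfolding M_def by blast
      obtain z where z: "z \<in> L" "dist (M *\<^sub>R x + b) z \<le> K" using lattice by blast
      define T where "T = (\<lambda>y. M *\<^sub>R y + (b - z))"
      \<comment> \<open>Pull a point \<open>y\<close> of \<open>- U\<close> back along the iterate:
        its source \<open>w\<close> cannot lie in \<open>U\<close>, because \<open>U\<close> is
        mapped into itself and has period \<open>z\<close>.\<close>
      have sub: "- U \<inter> ball 0 R \<subseteq> T ` (ball x (\<rho> / M) - U)"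
      proof
        fix y assume y: "y \<in> - U \<inter> ball 0 R"
        define w where "w = (1 / M) *\<^sub>R (y + z - b)"
        have Tw: "M *\<^sub>R w + b = y + z" using M(1) unfolding w_def by simp
        have "w \<notin> U" using b[of w] y period[OF z(1), of y] unfolding Tw by auto
        moreover have "dist x w < \<rho> / M"
        proof -
          have "M * dist x w = dist (M *\<^sub>R x + b) (M *\<^sub>R w + b)"
            using M(1) by (simp add: dist_norm flip: scaleR_diff_right)
          also have "\<dots> \<le> dist (M *\<^sub>R x + b) z + dist z (y + z)"
            unfolding Tw by (rule dist_triangle)
          also have "\<dots> < \<rho>" using y z(2) unfolding \<rho>_def by (auto simp: dist_norm)
          finally show ?thesis using M(1) by (simp add: field_simps)
        qed
        moreover have "y = T w" unfolding T_def using Tw by (metis add_diff_cancel_right' add_diff_eq)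
        ultimately show "y \<in> T ` (ball x (\<rho> / M) - U)" by auto
      qed
      have Tsets: "T ` (ball x (\<rho> / M) - U) \<in> lmeasurable"
        unfolding T_def using M(1) U by (intro lmeasurable_affinity) (auto simp: fmeasurable_Diff)
      have Tmeas: "measure lebesgue (T ` (ball x (\<rho> / M) - U)) = M ^ DIM('a) * measure lebesgue (ball x (\<rho> / M) - U)"
        unfolding T_def using measure_lebesgue_affine[of M "b - z"] M(1) by simp
      \<comment> \<open>Scaling of volume turns the relative deficit \<open>\<eta> / V\<close> at
        the density point into the absolute bound \<open>\<eta>\<close>.\<close>
      have "M ^ DIM('a) * measure lebesgue (ball x (\<rho> / M)) = V"
        unfolding V_def using \<rho> M(1) by (simp add: content_ball power_divide)
      moreover have "M ^ DIM('a) * measure lebesgue (ball x (\<rho> / M) - U)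
          \<le> M ^ DIM('a) * ((\<eta> / V) * measure lebesgue (ball x (\<rho> / M)))"
        using d(2)[of "\<rho> / M"] M \<rho> by (intro mult_left_mono) auto
      ultimately have "measure lebesgue (T ` (ball x (\<rho> / M) - U)) \<le> (\<eta> / V) * V"
        unfolding Tmeas by (metis mult.left_commute)
      then have "measure lebesgue (T ` (ball x (\<rho> / M) - U)) \<le> \<eta>" using V by simp
      with sub Tsets show "\<exists>W. - U \<inter> ball 0 R \<subseteq> W \<and> W \<in> lmeasurable \<and> measure lebesgue W \<le> \<eta>"
        by blast
    qed
    then have "negligible (- U)" unfolding negligible_iff_bounded_parts[of "- U"] by blast
    with \<open>\<not> negligible (- U)\<close> show False by simp
  qed
qed

text \<open>Take density points of \<open>U\<close> and of \<open>- U\<close> and a shift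
  \<open>t\<close> carrying one nearly to the other. The shifted \<open>U\<close> and
  \<open>- U\<close> then each fill more than three quarters of nearly coinciding balls, so they
  overlap in positive measure, contrary to \<open>invar\<close>.\<close>

lemma negligible_or_compl_of_dense_translations:
  fixes U :: "'a::euclidean_space set"
  assumes U: "U \<in> sets lebesgue"
    and dense: "\<And>x e. e > 0 \<Longrightarrow> \<exists>t\<in>T. dist x t < e"
    and invar: "\<And>t. t \<in> T \<Longrightarrow> negligible ((+) t ` U - U)"
  shows "negligible U \<or> negligible (- U)"
proof (rule ccontr)
  assume "\<not> ?thesis"
  then have nU: "\<not> negligible U" "\<not> negligible (- U)" by auto
  have U': "- U \<in> sets lebesgue" using U by (metis Compl_in_sets_lebesgue)
  obtain x d where d: "d > 0" "\<And>r. 0 < r \<Longrightarrow> r < d \<Longrightarrow>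
      measure lebesgue (ball x r - U) < 1/4 * measure lebesgue (ball x r)"
    using lebesgue_density_point[OF U nU(1)] by (metis zero_less_divide_1_iff zero_less_numeral)
  obtain y d' where d': "d' > 0" "\<And>r. 0 < r \<Longrightarrow> r < d' \<Longrightarrow>
      measure lebesgue (ball y r - - U) < 1/4 * measure lebesgue (ball y r)"
    using lebesgue_density_point[OF U' nU(2)] by (metis zero_less_divide_1_iff zero_less_numeral)
  define r where "r = min d d' / 2"
  have r: "0 < r" "r < d" "r < d'" using d(1) d'(1) unfolding r_def by auto
  \<comment> \<open>The ball enlarged by \<open>k\<close> has 5/4 of the volume, less than 3/4 +
    3/4, and leaves the slack \<open>k * r - r\<close> for approximating \<open>y - x\<close> by
    \<open>t\<close>.\<close>
  define k where "k = root DIM('a) (5/4)"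
  have k: "k > 1" "k ^ DIM('a) = 5/4" unfolding k_def by auto
  define b where "b = measure lebesgue (ball (0::'a) r)"
  have b: "b > 0" "\<And>z::'a. measure lebesgue (ball z r) = b"
    "\<And>z::'a. measure lebesgue (ball z (k * r)) = 5/4 * b"
    unfolding b_def using r k by (auto simp: content_ball power_mult_distrib)
  have "k * r - r > 0" using r(1) k(1) by simp
  then obtain t where t: "t \<in> T" "dist (y - x) t < k * r - r" using dense by blast
  have split: "measure lebesgue (ball z r \<inter> V) = b - measure lebesgue (ball z r - V)"
    if "V \<in> sets lebesgue" for z :: 'a and V
  proof -
    have "measure lebesgue (ball z r - (ball z r - V)) = measure lebesgue (ball z r) - measure lebesgue (ball z r - V)"
      using that by (intro measurable_measure_Diff) auto
    moreover have "ball z r - (ball z r - V) = ball z r \<inter> V" by auto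
    ultimately show ?thesis using b(2) by simp
  qed
  define A where "A = (+) t ` (ball x r \<inter> U)"
  define B where "B = ball y r \<inter> - U"
  have lm: "ball x r \<inter> U \<in> lmeasurable" "B \<in> lmeasurable"
    unfolding B_def using U U' by (auto intro: fmeasurable_Int_fmeasurable)
  then have A: "A \<in> lmeasurable" unfolding A_def using measurable_translation by blast
  have "measure lebesgue A > 3/4 * b"
    using d(2)[OF r(1,2)] split[OF U, of x] b(2) unfolding A_def measure_translation by simp
  moreover have "measure lebesgue B > 3/4 * b"
    using d'(2)[OF r(1,3)] split[OF U', of y] b(2) unfolding B_def by simp
  moreover have "measure lebesgue (A \<inter> B) = 0"
    using negligible_subset[OF invar[OF t(1)], of "A \<inter> B"] unfolding A_def B_def
    by (intro negligible_imp_measure0) blast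
  moreover have "measure lebesgue (A \<union> B) \<le> measure lebesgue (ball y (k * r))"
  proof (rule measure_mono_fmeasurable)
    have "r \<le> k * r" using r k by simp
    moreover have "A \<subseteq> ball y (k * r)"
    proof
      fix w assume "w \<in> A"
      then obtain v where v: "w = t + v" "dist x v < r" unfolding A_def by auto
      have "dist y w \<le> dist (y - x) t + dist x v"
      proof -
        have "y - w = ((y - x) - t) + (x - v)" using v(1) by simp
        then show ?thesis unfolding dist_norm by (metis norm_triangle_ineq)
      qed
      with t(2) v(2) show "w \<in> ball y (k * r)" by simp
    qed
    ultimately show "A \<union> B \<subseteq> ball y (k * r)" unfolding B_def by auto
    show "A \<union> B \<in> sets lebesgue" using A lm(2) by (intro sets.Un fmeasurableD)
  qed auto
  ultimately show False
    using measure_Un3[OF A lm(2)] b by simp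
qed

section \<open>Coprimality conditions\<close>

text \<open>
  \<open>\<Phi>\<close> constrains, for each common prime divisor of q, the set of columns j with p_j prime
  to it. The three sets of the theorem are the cases \<open>\<Phi> J\<close> = true, J nonempty, J full.
\<close>
definition admissible :: "('m set \<Rightarrow> bool) \<Rightarrow> int^'m \<Rightarrow> int^'n \<Rightarrow> bool" where
  "admissible \<Phi> p q \<longleftrightarrow> (\<forall>r. prime r \<longrightarrow> (\<forall>i. r dvd q$i) \<longrightarrow> \<Phi> {j. \<not> r dvd p$j})"

lemma Gcd_eq_1_iff_prime:
  fixes S :: "int set"
  shows "Gcd S = 1 \<longleftrightarrow> (\<forall>r. prime r \<longrightarrow> (\<exists>s\<in>S. \<not> r dvd s))"
proof
  assume "Gcd S = 1"
  then show "\<forall>r. prime r \<longrightarrow> (\<exists>s\<in>S. \<not> r dvd s)"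
    by (metis Gcd_greatest not_prime_unit)
next
  assume *: "\<forall>r. prime r \<longrightarrow> (\<exists>s\<in>S. \<not> r dvd s)"
  have "\<not> r dvd Gcd S" if "prime r" for r using * that dvd_trans Gcd_dvd by blast
  \<comment> \<open>This covers \<open>Gcd S = 0\<close>, where \<open>prime_divisor_exists\<close>
    does not apply: 0 is divisible by 2.\<close>
  moreover have "prime (2::int)" by simp
  ultimately have "is_unit (Gcd S)" by (metis dvd_0_right prime_divisor_exists)
  then show "Gcd S = 1" by simp
qed

lemma admissible_nonempty_iff:
  "admissible (\<lambda>J. J \<noteq> {}) p q \<longleftrightarrow> Gcd (range (\<lambda>j. p$j) \<union> range (\<lambda>i. q$i)) = 1"
  unfolding admissible_def Gcd_eq_1_iff_prime by (simp add: bex_Un set_eq_iff, blast)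

lemma admissible_UNIV_iff:
  "admissible (\<lambda>J. J = UNIV) p q \<longleftrightarrow> (\<forall>j. Gcd (insert (p$j) (range (\<lambda>i. q$i))) = 1)"
  unfolding admissible_def Gcd_eq_1_iff_prime by (simp add: bex_Un set_eq_iff, blast)

section \<open>Changes of \<open>p\<close> that preserve admissibility\<close>

text \<open>A common prime divisor of \<open>q\<close> differs from \<open>l\<close>, so multiplying
  by \<open>l\<close> does not affect which \<open>p$j\<close> it divides.\<close>

lemma admissible_scale:
  assumes "prime l" "\<not> l dvd q$i" "admissible \<Phi> p q"
  shows "admissible \<Phi> (\<chi> j. l * p$j) q"
  unfolding admissible_def
proof (intro allI impI)
  fix r :: int assume r: "prime r" "\<forall>i. r dvd q$i"
  then have "r \<noteq> l" using assms(2) by blast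
  then have "\<not> r dvd l" using r(1) assms(1) primes_dvd_imp_eq by blast
  then have "{j. \<not> r dvd (\<chi> j. l * p$j) $ j} = {j. \<not> r dvd p$j}"
    using r(1) by (simp add: prime_dvd_mult_iff)
  then show "\<Phi> {j. \<not> r dvd (\<chi> j. l * p$j) $ j}" using r assms(3) unfolding admissible_def by simp
qed

text \<open>Serves the translations by integer matrices and by integer matrices over
  \<open>l\<close>: both alter \<open>p\<close> by a vector that vanishes modulo every common prime
  of \<open>q\<close>.\<close>

lemma admissible_add:
  assumes "admissible \<Phi> p q" "\<And>r j. prime r \<Longrightarrow> \<forall>i. r dvd q$i \<Longrightarrow> r dvd v$j"
  shows "admissible \<Phi> (p + v) q"
  unfolding admissible_def
proof (intro allI impI)
  fix r :: int assume r: "prime r" "\<forall>i. r dvd q$i"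
  have "{j. \<not> r dvd (p + v) $ j} = {j. \<not> r dvd p$j}"
    using assms(2)[OF r] by (simp add: dvd_add_left_iff)
  then show "\<Phi> {j. \<not> r dvd (p + v) $ j}" using r assms(1) unfolding admissible_def by simp
qed

text \<open>Modulo \<open>l\<close> every new entry is \<open>- c\<close>, which is nonzero, so all
  columns are prime to \<open>l\<close> and \<open>\<Phi> UNIV\<close> applies. Any other common
  prime divides \<open>c\<close> and leaves the divisibility pattern unchanged.\<close>

lemma admissible_scale_shift:
  assumes "\<Phi> UNIV" "prime l" "q$k = l * c" "\<not> l dvd c" "admissible \<Phi> p q"
  shows "admissible \<Phi> (\<chi> j. l * p$j - c) q"
  unfolding admissible_def
proof (intro allI impI)
  fix r :: int assume r: "prime r" "\<forall>i. r dvd q$i"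
  show "\<Phi> {j. \<not> r dvd (\<chi> j. l * p$j - c) $ j}"
  proof (cases "r = l")
    case True
    have "\<not> l dvd l * p$j - c" for j
      using assms(4) by (metis diff_eq_eq dvd_add_right_iff dvd_triv_left add.commute)
    then have "{j. \<not> r dvd (\<chi> j. l * p$j - c) $ j} = UNIV" using True by simp
    then show ?thesis using assms(1) by metis
  next
    case False
    then have nd: "\<not> r dvd l" using r(1) assms(2) primes_dvd_imp_eq by blast
    have "r dvd q$k" using r(2) by blast
    then have "r dvd c" using nd r(1) assms(3) by (simp add: prime_dvd_mult_iff)
    then have "r dvd l * p$j - c \<longleftrightarrow> r dvd p$j" for j
      using nd r(1) by (metis dvd_diff dvd_diff_commute dvd_mult prime_dvd_mult_iff diff_add_cancel dvd_add)
    then show ?thesis using r assms(5) unfolding admissible_def by simp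
  qed
qed

section \<open>Gaps between integers prime to \<open>d\<close>\<close>

text \<open>Two neighbouring terms are produced because one may have to be discarded: a prime not
  dividing \<open>D\<close> divides at most one of them.\<close>

lemma ex_progression_near:
  fixes y :: real and D :: int
  assumes "D \<ge> 1"
  obtains t :: int where "\<bar>y + of_int (1 + D * t)\<bar> \<le> 2 * D" "\<bar>y + of_int (1 + D * (t + 1))\<bar> \<le> 2 * D"
proof -
  \<comment> \<open>With this floor the two sums lie in \<open>(1 - D, 1]\<close> and
    \<open>(1, 1 + D]\<close>.\<close>
  define t where "t = \<lfloor>- y / D\<rfloor>"
  have D: "real_of_int D \<ge> 1" using assms by simp
  have "of_int t \<le> - y / D" "- y / D < of_int t + 1" unfolding t_def by linarith+
  then have *: "D * of_int t \<le> - y" "- y < D * of_int t + D"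
    using D by (simp_all add: field_simps)
  have **: "real_of_int (1 + D * t) = 1 + D * of_int t" "real_of_int (1 + D * (t + 1)) = 1 + D * of_int t + D"
    by (simp_all add: algebra_simps)
  show thesis
    by (rule that[of t]; unfold ** abs_le_iff; use * D in linarith)
qed

text \<open>
  If d has a large prime factor P with cofactor d' prime to P, then of two consecutive numbers
  congruent to 1 modulo d' one is prime to d; otherwise all numbers congruent to 1 modulo N! are.
  This o(d) bound on gaps is what handles infinitely many q with \<open>\<Psi>\<close>(q)/|q| bounded below.
\<close>
lemma ex_coprime_near:
  fixes y :: real and d :: int
  assumes d: "d \<noteq> 0" and N: "N > (0::nat)"
  shows "\<exists>a. coprime a d \<and> \<bar>y + of_int a\<bar> \<le> 2 * \<bar>d\<bar> / N + 2 * fact N"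
proof (cases "\<exists>P. prime P \<and> P > int N \<and> P dvd d")
  case True
  then obtain P where P: "prime P" "P > int N" "P dvd d" by blast
  obtain d' where d': "d = P ^ multiplicity P d * d'" "\<not> P dvd d'"
    using multiplicity_decompose'[of d P] d P(1) not_prime_unit by (metis)
  define D where "D = \<bar>d'\<bar>"
  have "d' \<noteq> 0" using d'(2) by auto
  then have D: "D \<ge> 1" unfolding D_def by simp
  have PD: "\<not> P dvd D" using d'(2) unfolding D_def by simp
  obtain t where t: "\<bar>y + of_int (1 + D * t)\<bar> \<le> 2 * D" "\<bar>y + of_int (1 + D * (t + 1))\<bar> \<le> 2 * D"
    using ex_progression_near[OF D] by blast
  have "\<not> (P dvd 1 + D * t \<and> P dvd 1 + D * (t + 1))"
  proof
    assume "P dvd 1 + D * t \<and> P dvd 1 + D * (t + 1)"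
    then have "P dvd (1 + D * (t + 1)) - (1 + D * t)" by (intro dvd_diff) auto
    then show False using PD by (simp add: algebra_simps)
  qed
  then obtain s where s: "\<not> P dvd 1 + D * s" "\<bar>y + of_int (1 + D * s)\<bar> \<le> 2 * D" using t by blast
  have "coprime (1 + D * s) P" using s(1) P(1) by (metis coprime_commute prime_imp_coprime)
  moreover have "coprime (1 + D * s) D"
    by (metis coprime_1_left coprime_add_one_left coprime_commute coprime_mult_left_iff gcd_add_mult add.commute coprime_iff_gcd_eq_1 gcd.commute mult.commute)
  ultimately have "coprime (1 + D * s) d"
    using d'(1) unfolding D_def by (metis coprime_abs_right_iff coprime_mult_right_iff coprime_power_right_iff)
  \<comment> \<open>The prime \<open>P > N\<close> splits off at least once, so the cofactor is at
    most \<open>\<bar>d\<bar> / N\<close>.\<close>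
  moreover have "2 * real_of_int D \<le> 2 * \<bar>d\<bar> / N"
  proof -
    have "P dvd P ^ multiplicity P d"
      using d P(1,3) by (metis dvd_power multiplicity_eq_zero_iff not_gr_zero not_prime_unit)
    then have "P * d' dvd d" using d'(1) by (metis dvd_refl mult_dvd_mono)
    then have "\<bar>P * d'\<bar> \<le> \<bar>d\<bar>" using d dvd_imp_le_int by blast
    then have "P * D \<le> \<bar>d\<bar>" unfolding D_def using P(2) by (simp add: abs_mult)
    moreover have "int N * D \<le> P * D" using P(2) D by (intro mult_right_mono) auto
    ultimately have "int N * D \<le> \<bar>d\<bar>" by linarith
    then have "real_of_int (int N * D) \<le> real_of_int \<bar>d\<bar>" by (simp only: of_int_le_iff)
    then show ?thesis using N by (simp add: field_simps)
  qed
  moreover have "(0::real) \<le> 2 * fact N" by simp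
  ultimately have "coprime (1 + D * s) d" "\<bar>y + of_int (1 + D * s)\<bar> \<le> 2 * \<bar>d\<bar> / N + 2 * fact N"
    using s(2) by linarith+
  then show ?thesis by blast
next
  case False
  define D where "D = int (fact N)"
  have D: "D \<ge> 1" "real_of_int D = fact N" unfolding D_def by (simp_all add: Suc_leI)
  obtain t where t: "\<bar>y + of_int (1 + D * t)\<bar> \<le> 2 * D"
    using ex_progression_near[OF D(1)] by blast
  have "coprime (1 + D * t) d"
  proof (rule ccontr)
    assume "\<not> coprime (1 + D * t) d"
    then have "gcd (1 + D * t) d \<noteq> 1" by (simp add: coprime_iff_gcd_eq_1)
    then obtain r where r: "prime r" "r dvd gcd (1 + D * t) d"
      using prime_divisor_exists[of "gcd (1 + D * t) d"] d by auto
    then have rd: "r dvd 1 + D * t" "r dvd d" by auto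
    then have "r \<le> int N" using rd(2) False r(1) by (metis not_le)
    then have "nat r dvd fact N" using prime_gt_0_int[OF r(1)] by (intro dvd_fact) linarith+
    then have "r dvd D" unfolding D_def using prime_gt_0_int[OF r(1)]
      by (metis int_dvd_int_iff int_nat_eq order_less_imp_le)
    then have "r dvd 1" using rd(1) by (metis dvd_add_left_iff dvd_mult2)
    then show False using r(1) not_prime_unit by blast
  qed
  moreover have "0 \<le> 2 * real_of_int \<bar>d\<bar> / N" by simp
  ultimately have "coprime (1 + D * t) d" "\<bar>y + of_int (1 + D * t)\<bar> \<le> 2 * \<bar>d\<bar> / N + 2 * fact N"
    using t D(2) by linarith+
  then show ?thesis by blast
qed

section \<open>Limsup sets\<close>

definition vreal :: "int^'n \<Rightarrow> real^'n" where
  "vreal q = (\<chi> i. real_of_int (q$i))"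

definition mreal :: "int^'m^'n \<Rightarrow> real^'m^'n" where
  "mreal E = (\<chi> i. vreal (E$i))"

lemma vreal_nth [simp]: "vreal q $ i = real_of_int (q$i)"
  by (simp add: vreal_def)

lemma mreal_nth [simp]: "mreal E $ i $ j = real_of_int (E$i$j)"
  by (simp add: mreal_def)

lemma vreal_eq_0_iff [simp]: "vreal q = 0 \<longleftrightarrow> q = 0"
  by (simp add: vec_eq_iff)

lemma vector_matrix_mult_nth:
  fixes x :: "'a::comm_semiring_1^'n"
  shows "(x v* A) $ j = (\<Sum>i\<in>UNIV. A$i$j * x$i)"
  by (simp add: vector_matrix_mult_def mult.commute)

lemma qXp_eq: "qXp q X p = vreal q v* X + vreal p"
  by (simp add: qXp_def vreal_def)

lemma vector_matrix_mult_affine: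
  fixes x :: "real^'n" and A B :: "real^'m^'n"
  shows "x v* (a *\<^sub>R A + B) = a *\<^sub>R (x v* A) + x v* B"
  by (simp add: vec_eq_iff vector_matrix_mult_nth distrib_right sum.distrib sum_distrib_left mult.assoc)

lemma abs_vector_matrix_mult_nth_le:
  fixes x :: "real^'n" and A :: "real^'m^'n"
  shows "\<bar>(x v* A) $ j\<bar> \<le> norm x * norm A"
proof -
  have "(x v* A) $ j = x \<bullet> (\<chi> i. A$i$j)"
    by (simp add: vector_matrix_mult_nth inner_vec_def mult.commute)
  then have "\<bar>(x v* A) $ j\<bar> \<le> norm x * norm (\<chi> i. A$i$j)"
    by (simp add: Cauchy_Schwarz_ineq2)
  also have "norm (\<chi> i. A$i$j) \<le> norm A"
    unfolding norm_vec_def[of A] norm_vec_def[of "\<chi> i. A$i$j"]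
    by (intro L2_set_mono) (auto intro: component_le_norm_cart)
  finally show ?thesis by (simp add: mult_left_mono)
qed

lemma norm_vec_le:
  fixes x :: "'a::real_normed_vector^'n" and B :: real
  assumes "\<And>i. norm (x$i) \<le> B"
  shows "norm x \<le> CARD('n) * B"
proof -
  have "norm x \<le> (\<Sum>i\<in>UNIV. norm (x$i))" unfolding norm_vec_def by (rule L2_set_le_sum) simp
  also have "\<dots> \<le> (\<Sum>i\<in>(UNIV::'n set). B)" using assms by (intro sum_mono)
  finally show ?thesis by simp
qed

lemma finite_int_vec_bounded: "finite {q::int^'n. \<forall>i. \<bar>real_of_int (q$i)\<bar> \<le> B}"
proof (rule finite_subset)
  show "{q::int^'n. \<forall>i. \<bar>real_of_int (q$i)\<bar> \<le> B}
     \<subseteq> vec_lambda ` (UNIV \<rightarrow>\<^sub>E {- \<lceil>B\<rceil>..\<lceil>B\<rceil>})"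
  proof
    fix q :: "int^'n" assume q: "q \<in> {q. \<forall>i. \<bar>real_of_int (q$i)\<bar> \<le> B}"
    have "- \<lceil>B\<rceil> \<le> q$i \<and> q$i \<le> \<lceil>B\<rceil>" for i
    proof -
      have "\<bar>real_of_int (q$i)\<bar> \<le> B" using q by blast
      then show ?thesis by linarith
    qed
    then have "vec_nth q \<in> (UNIV \<rightarrow>\<^sub>E {- \<lceil>B\<rceil>..\<lceil>B\<rceil>})" by auto
    then show "q \<in> vec_lambda ` (UNIV \<rightarrow>\<^sub>E {- \<lceil>B\<rceil>..\<lceil>B\<rceil>})"
      by (metis image_eqI vec_nth_inverse)
  qed
qed (auto intro!: finite_imageI finite_PiE)

lemma finite_norm_vreal_le: "finite {q::int^'n. norm (vreal q) \<le> B}"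
  by (rule finite_subset[OF _ finite_int_vec_bounded[of B]])
    (use component_le_norm_cart[of "vreal _"] in \<open>auto intro: order_trans\<close>)

text \<open>Entrywise floors suffice. The constant is crude, but it does not depend on
  \<open>X\<close>: integer matrices form a coarse net, and a fine one after division by a large
  \<open>l\<close>.\<close>

lemma ex_mreal_near: "\<exists>E. dist X (mreal E :: real^'m^'n) \<le> CARD('n) * CARD('m)"
proof
  let ?E = "\<chi> i j. \<lfloor>X$i$j\<rfloor>"
  have "norm ((X - mreal ?E) $ i $ j) \<le> 1" for i j
    by simp linarith
  then have "norm ((X - mreal ?E) $ i) \<le> CARD('m)" for i
    using norm_vec_le[of "(X - mreal ?E) $ i" 1] by simp
  then have "norm (X - mreal ?E) \<le> CARD('n) * real CARD('m)" by (rule norm_vec_le)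
  then show "dist X (mreal ?E) \<le> CARD('n) * CARD('m)" by (simp add: dist_norm)
qed

section \<open>Neighbourhoods and their limsup sets\<close>

text \<open>All real matrices are allowed, not only those of the unit cube, so that affine maps and
  translations act freely; the cube returns at the end.\<close>

definition near_set :: "('m set \<Rightarrow> bool) \<Rightarrow> (int^'n \<Rightarrow> real) \<Rightarrow> int^'n \<Rightarrow> (real^'m^'n) set" where
  "near_set \<Phi> \<Psi> q = {X. \<exists>p. admissible \<Phi> p q \<and> (\<forall>j. \<bar>qXp q X p $ j\<bar> < \<Psi> q)}"

text \<open>Only \<open>q\<close> is counted, and \<open>Q\<close> is a parameter so that classes
  given by divisibility can be treated separately.\<close>

definition limsup_set :: "('m set \<Rightarrow> bool) \<Rightarrow> (int^'n \<Rightarrow> real) \<Rightarrow> (int^'n) set \<Rightarrow> (real^'m^'n) set" where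
  "limsup_set \<Phi> \<Psi> Q = {X. infinite {q\<in>Q. X \<in> near_set \<Phi> \<Psi> q}}"

lemma open_near_set: "open (near_set \<Phi> \<Psi> q)"
proof -
  have "near_set \<Phi> \<Psi> q = (\<Union>p\<in>{p. admissible \<Phi> p q}. \<Inter>j. {X. \<bar>qXp q X p $ j\<bar> < \<Psi> q})"
    unfolding near_set_def by auto
  moreover have "open {X. \<bar>qXp q X p $ j\<bar> < \<Psi> q}" for p j
    unfolding qXp_eq vector_add_component vector_matrix_mult_nth
    by (intro open_Collect_less continuous_intros)
  ultimately show ?thesis by (auto intro!: open_UN open_INT)
qed

text \<open>A limsup of open sets is an intersection, over the finite exception sets
  \<open>F\<close>, of open unions; there are only countably many such \<open>F\<close>.\<close>

lemma limsup_set_measurable: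
  fixes Q :: "(int^'n) set"
  shows "limsup_set \<Phi> \<Psi> Q \<in> sets lebesgue"
proof -
  have "limsup_set \<Phi> \<Psi> Q = (\<Inter>F\<in>{F. finite F}. \<Union>q\<in>Q - F. near_set \<Phi> \<Psi> q)" (is "_ = ?R")
  proof (intro equalityI subsetI)
    fix X assume X: "X \<in> limsup_set \<Phi> \<Psi> Q"
    show "X \<in> ?R"
    proof (rule INT_I)
      fix F :: "(int^'n) set" assume "F \<in> {F. finite F}"
      then have "infinite ({q\<in>Q. X \<in> near_set \<Phi> \<Psi> q} - F)"
        using X unfolding limsup_set_def by simp
      then have "{q\<in>Q. X \<in> near_set \<Phi> \<Psi> q} - F \<noteq> {}" by (metis finite.emptyI)
      then show "X \<in> (\<Union>q\<in>Q - F. near_set \<Phi> \<Psi> q)" by blast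
    qed
  next
    fix X assume X: "X \<in> ?R"
    \<comment> \<open>Take as exception set all \<open>q\<close> in \<open>Q\<close> that
      approximate \<open>X\<close>: were it finite, membership in \<open>?R\<close> would supply one
      more.\<close>
    have "X \<notin> (\<Union>q\<in>Q - {q\<in>Q. X \<in> near_set \<Phi> \<Psi> q}. near_set \<Phi> \<Psi> q)" by blast
    then have "{q\<in>Q. X \<in> near_set \<Phi> \<Psi> q} \<notin> {F. finite F}" using X by blast
    then show "X \<in> limsup_set \<Phi> \<Psi> Q" unfolding limsup_set_def by simp
  qed
  moreover have "?R \<in> sets borel"
  proof (rule sets.countable_INT'')
    show "countable {F::(int^'n) set. finite F}" by (rule countable_Collect_finite)
  qed (auto intro!: borel_open open_UN open_near_set)
  ultimately show ?thesis by (metis sets_completionI_sets sets_lborel)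
qed

lemma limsup_set_mono: "Q \<subseteq> Q' \<Longrightarrow> limsup_set \<Phi> \<Psi> Q \<subseteq> limsup_set \<Phi> \<Psi> Q'"
  unfolding limsup_set_def by (auto elim!: contrapos_nn intro: finite_subset[rotated])

lemma limsup_set_Un: "limsup_set \<Phi> \<Psi> (Q \<union> Q') = limsup_set \<Phi> \<Psi> Q \<union> limsup_set \<Phi> \<Psi> Q'"
proof -
  have "{q\<in>Q \<union> Q'. X \<in> near_set \<Phi> \<Psi> q} = {q\<in>Q. X \<in> near_set \<Phi> \<Psi> q} \<union> {q\<in>Q'. X \<in> near_set \<Phi> \<Psi> q}"
    for X by blast
  then show ?thesis unfolding limsup_set_def by auto
qed

lemma limsup_set_UN:
  "finite I \<Longrightarrow> limsup_set \<Phi> \<Psi> (\<Union>i\<in>I. Q i) = (\<Union>i\<in>I. limsup_set \<Phi> \<Psi> (Q i))"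
proof (induction I rule: finite_induct)
  case empty
  then show ?case by (simp add: limsup_set_def)
qed (simp add: limsup_set_Un)

text \<open>With \<open>p' = a p - qC\<close>, the identity
  \<open>q(aX + C) + p' = a(qX + p)\<close> keeps \<open>q\<close> and scales the error by
  \<open>a\<close>. The expanding maps and both kinds of translation are instances.\<close>

lemma limsup_set_affine:
  assumes a: "a > 0"
    and step: "\<And>q p. q \<in> Q \<Longrightarrow> admissible \<Phi> p q \<Longrightarrow>
                 \<exists>p'. admissible \<Phi> p' q \<and> vreal p' = a *\<^sub>R vreal p - vreal q v* C"
    and X: "X \<in> limsup_set \<Phi> \<Psi> Q"
  shows "a *\<^sub>R X + C \<in> limsup_set \<Phi> (\<lambda>q. a * \<Psi> q) Q"
proof -
  have "a *\<^sub>R X + C \<in> near_set \<Phi> (\<lambda>q. a * \<Psi> q) q" if q: "q \<in> Q" "X \<in> near_set \<Phi> \<Psi> q" for q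
  proof -
    obtain p where p: "admissible \<Phi> p q" "\<And>j. \<bar>qXp q X p $ j\<bar> < \<Psi> q"
      using q(2) unfolding near_set_def by blast
    obtain p' where p': "admissible \<Phi> p' q" "vreal p' = a *\<^sub>R vreal p - vreal q v* C"
      using step[OF q(1) p(1)] by blast
    have "qXp q (a *\<^sub>R X + C) p' = a *\<^sub>R qXp q X p"
      unfolding qXp_eq vector_matrix_mult_affine p'(2) by (simp add: algebra_simps)
    then have "\<bar>qXp q (a *\<^sub>R X + C) p' $ j\<bar> < a * \<Psi> q" for j
      using p(2)[of j] a by (simp add: abs_mult)
    then show ?thesis using p'(1) unfolding near_set_def by blast
  qed
  then have "{q\<in>Q. X \<in> near_set \<Phi> \<Psi> q} \<subseteq> {q\<in>Q. a *\<^sub>R X + C \<in> near_set \<Phi> (\<lambda>q. a * \<Psi> q) q}" by blast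
  then show ?thesis using X finite_subset unfolding limsup_set_def by blast
qed

text \<open>Replacing \<open>p\<close> by \<open>p - qE\<close> changes each entry by an integer
  combination of the entries of \<open>q\<close>, hence by a multiple of each of their common
  primes.\<close>

lemma limsup_set_periodic:
  assumes "X \<in> limsup_set \<Phi> \<Psi> Q"
  shows "X + mreal E \<in> limsup_set \<Phi> \<Psi> Q"
proof -
  have "\<exists>p'. admissible \<Phi> p' q \<and> vreal p' = 1 *\<^sub>R vreal p - vreal q v* mreal E"
    if "admissible \<Phi> p q" for p q
  proof (intro exI conjI)
    let ?v = "\<chi> j. - (\<Sum>i\<in>UNIV. E$i$j * q$i)"
    show "admissible \<Phi> (p + ?v) q"
      by (rule admissible_add[OF that]) (auto intro!: dvd_sum)
    show "vreal (p + ?v) = 1 *\<^sub>R vreal p - vreal q v* mreal E"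
      by (simp add: vec_eq_iff vector_matrix_mult_nth)
  qed
  from limsup_set_affine[of 1, OF _ this assms] show ?thesis by simp
qed

text \<open>The rank-one matrix \<open>Z\<close>, the outer product of \<open>q\<close> and the
  error \<open>w\<close> over the squared norm of \<open>q\<close>, satisfies \<open>qZ = w\<close>.
  So \<open>Y = X - Z\<close> solves \<open>qY + p = 0\<close> exactly, and away from an exact
  solution the error is at most the norm of \<open>q\<close> times the distance.\<close>

lemma near_set_inner_ball:
  fixes X :: "real^'m^'n" and c :: real
  assumes q: "q \<noteq> 0" and X: "X \<in> near_set \<Phi> (\<lambda>q. c * \<Psi> q) q"
  obtains Y where "dist X Y \<le> CARD('n) * CARD('m) * c * (\<Psi> q / norm (vreal q))"
    "ball Y (\<Psi> q / norm (vreal q)) \<subseteq> near_set \<Phi> \<Psi> q"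
proof -
  obtain p where p: "admissible \<Phi> p q" "\<And>j. \<bar>qXp q X p $ j\<bar> < c * \<Psi> q"
    using X unfolding near_set_def by blast
  define u where "u = vreal q"
  define w where "w = qXp q X p"
  have u: "norm u > 0" using q unfolding u_def by simp
  define Z :: "real^'m^'n" where "Z = (\<chi> i. (u$i / (norm u)\<^sup>2) *\<^sub>R w)"
  have uZ: "u v* Z = w"
  proof -
    have "(\<Sum>i\<in>UNIV. u$i * u$i) = (norm u)\<^sup>2"
      by (simp add: power2_norm_eq_inner inner_vec_def)
    then have "(\<Sum>i\<in>UNIV. Z$i$j * u$i) = (w$j / (norm u)\<^sup>2) * (norm u)\<^sup>2" for j
      unfolding Z_def by (simp add: mult_ac flip: sum_divide_distrib sum_distrib_left)
    moreover have "(norm u)\<^sup>2 \<noteq> 0" using u by simp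
    ultimately have "(\<Sum>i\<in>UNIV. Z$i$j * u$i) = w$j" for j
      by (metis nonzero_eq_divide_eq times_divide_eq_left)
    then show ?thesis by (simp add: vec_eq_iff vector_matrix_mult_nth)
  qed
  have "norm w \<le> CARD('m) * (c * \<Psi> q)"
    using p(2) unfolding w_def by (intro norm_vec_le) (auto intro: less_imp_le)
  then have "norm (Z$i) \<le> (1 / norm u) * (CARD('m) * (c * \<Psi> q))" for i
  proof -
    have "norm (Z$i) = (\<bar>u$i\<bar> / (norm u)\<^sup>2) * norm w" unfolding Z_def by simp
    also have "\<dots> \<le> (norm u / (norm u)\<^sup>2) * norm w"
      by (intro mult_right_mono divide_right_mono component_le_norm_cart) auto
    also have "\<dots> = (1 / norm u) * norm w" using u by (simp add: power2_eq_square)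
    also have "\<dots> \<le> (1 / norm u) * (CARD('m) * (c * \<Psi> q))"
      by (rule mult_left_mono) (use \<open>norm w \<le> _\<close> in auto)
    finally show ?thesis .
  qed
  then have nZ: "norm Z \<le> CARD('n) * ((1 / norm u) * (CARD('m) * (c * \<Psi> q)))" by (rule norm_vec_le)
  show thesis
  proof (rule that[of "X - Z"])
    show "dist X (X - Z) \<le> CARD('n) * CARD('m) * c * (\<Psi> q / norm (vreal q))"
      using nZ unfolding u_def by (simp add: dist_norm mult_ac)
    show "ball (X - Z) (\<Psi> q / norm (vreal q)) \<subseteq> near_set \<Phi> \<Psi> q"
    proof
      fix V assume V: "V \<in> ball (X - Z) (\<Psi> q / norm (vreal q))"
      define G where "G = V - (X - Z)"
      have G: "norm G < \<Psi> q / norm u"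
        using V unfolding G_def u_def by (simp add: dist_norm norm_minus_commute)
      have "u v* X = u v* (1 *\<^sub>R Z + (X - Z))" by simp
      then have "u v* (X - Z) = u v* X - w"
        unfolding vector_matrix_mult_affine uZ by (simp add: algebra_simps)
      moreover have "u v* V = u v* (1 *\<^sub>R G + (X - Z))" unfolding G_def by simp
      ultimately have "u v* V = u v* G + u v* X - w"
        unfolding vector_matrix_mult_affine by simp
      then have eq: "qXp q V p = u v* G"
        unfolding qXp_eq w_def u_def by simp
      have "\<bar>qXp q V p $ j\<bar> < \<Psi> q" for j
      proof -
        have "\<bar>qXp q V p $ j\<bar> \<le> norm u * norm G" unfolding eq by (rule abs_vector_matrix_mult_nth_le)
        also have "\<dots> < norm u * (\<Psi> q / norm u)" using G u by (intro mult_strict_left_mono)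
        finally show ?thesis using u by simp
      qed
      then show "V \<in> near_set \<Phi> \<Psi> q" using p(1) unfolding near_set_def by blast
    qed
  qed
qed

section \<open>The zero-one law\<close>

text \<open>
  Cassels' lemma: near any point of the larger limsup set, the smaller neighbourhoods fill a fixed
  proportion of arbitrarily small balls, so the difference has no density points.
\<close>
lemma limsup_set_scale_negligible:
  fixes \<Psi> :: "int^'n \<Rightarrow> real"
  assumes pos: "\<And>q. \<Psi> q > 0" and c: "c > 0" and Q: "0 \<notin> Q"
    and small: "\<And>e. e > 0 \<Longrightarrow> finite {q\<in>Q. \<Psi> q \<ge> e * norm (vreal q)}"
  shows "negligible (limsup_set \<Phi> (\<lambda>q. c * \<Psi> q) Q - limsup_set \<Phi> \<Psi> Q :: (real^'m^'n) set)"
proof -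
  define W where "W = (limsup_set \<Phi> (\<lambda>q. c * \<Psi> q) Q :: (real^'m^'n) set)"
  \<comment> \<open>\<open>D F\<close> collects the points of \<open>W\<close> whose good
    \<open>q\<close> for \<open>\<Psi>\<close> all lie in \<open>F\<close>; the countably many
    \<open>D F\<close> with \<open>F\<close> finite cover the difference.\<close>
  define D where "D F = W - (\<Union>q\<in>Q - F. near_set \<Phi> \<Psi> q)" for F
  have "negligible (D F)" if F: "finite F" for F
  proof (rule ccontr)
    assume nn: "\<not> negligible (D F)"
    have open_near: "open (\<Union>q\<in>Q - F. near_set \<Phi> \<Psi> q :: (real^'m^'n) set)"
      by (intro open_UN ballI open_near_set)
    have D_sets: "D F \<in> sets lebesgue"
      unfolding D_def W_def using limsup_set_measurable open_near by (intro sets.Diff) auto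
    \<comment> \<open>In units of the inner radius, \<open>K - 1\<close> bounds the distance from
      \<open>X\<close> to the inner centre \<open>Y\<close>; the extra 1 makes room for the ball
      about \<open>Y\<close>.\<close>
    define K where "K = real CARD('n) * CARD('m) * c + 1"
    have K: "K > 0" using c unfolding K_def by (simp add: add_pos_pos)
    define dim where "dim = DIM(real^'m^'n)"
    obtain X where X: "X \<in> D F" "\<And>e. e > 0 \<Longrightarrow> \<exists>d>0. \<forall>r. 0 < r \<longrightarrow> r < d \<longrightarrow>
        measure lebesgue (ball X r - D F) < e * measure lebesgue (ball X r)"
      using lebesgue_density_point[OF D_sets nn] by metis
    \<comment> \<open>This is the volume ratio of the inner ball to the outer one; an inner ball
      missing \<open>D F\<close> therefore contradicts the density estimate.\<close>
    have "1 / K ^ dim > 0" using K by simp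
    from X(2)[OF this] obtain d where d: "d > 0" "\<And>r. 0 < r \<Longrightarrow> r < d \<Longrightarrow>
        measure lebesgue (ball X r - D F) < 1 / K ^ dim * measure lebesgue (ball X r)"
      by blast
    define A where "A = {q\<in>Q. X \<in> near_set \<Phi> (\<lambda>q. c * \<Psi> q) q}"
    \<comment> \<open>These are the \<open>q\<close> whose outer ball is too large for the density
      estimate; \<open>small\<close> leaves only finitely many.\<close>
    define B where "B = {q\<in>Q. \<Psi> q \<ge> (d / K) * norm (vreal q)}"
    have "infinite A"
      using X(1) unfolding A_def D_def W_def limsup_set_def by simp
    moreover have "finite B" unfolding B_def by (rule small) (use d(1) K in simp)
    ultimately have "infinite (A - (F \<union> B))" using F by simp
    then obtain q where "q \<in> A - (F \<union> B)" using infinite_imp_nonempty by blast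
    then have q: "q \<in> Q" "X \<in> near_set \<Phi> (\<lambda>q. c * \<Psi> q) q" "q \<notin> F"
      "\<Psi> q < (d / K) * norm (vreal q)"
      unfolding A_def B_def by auto
    have nq: "norm (vreal q) > 0" and "q \<noteq> 0" using Q q(1) by auto
    define \<delta> where "\<delta> = \<Psi> q / norm (vreal q)"
    have \<delta>: "\<delta> > 0" "K * \<delta> < d" using pos[of q] nq q(4) K unfolding \<delta>_def by (auto simp: field_simps)
    obtain Y where Y: "dist X Y \<le> CARD('n) * CARD('m) * c * \<delta>" "ball Y \<delta> \<subseteq> near_set \<Phi> \<Psi> q"
      using near_set_inner_ball[OF \<open>q \<noteq> 0\<close> q(2)] unfolding \<delta>_def by blast
    have "ball Y \<delta> \<subseteq> ball X (K * \<delta>)"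
    proof
      fix Z assume "Z \<in> ball Y \<delta>"
      then show "Z \<in> ball X (K * \<delta>)"
        using Y(1) dist_triangle[of X Z Y] unfolding K_def by (simp add: distrib_right)
    qed
    moreover have "ball Y \<delta> \<inter> D F = {}" using Y(2) q(1,3) unfolding D_def by blast
    ultimately have "ball Y \<delta> \<subseteq> ball X (K * \<delta>) - D F" by blast
    then have "measure lebesgue (ball Y \<delta>) \<le> measure lebesgue (ball X (K * \<delta>) - D F)"
      using D_sets by (intro measure_mono_fmeasurable) (auto simp: fmeasurable_Diff)
    also have "\<dots> < 1 / K ^ dim * measure lebesgue (ball X (K * \<delta>))"
      using d(2) \<delta> K by simp
    also have "\<dots> = measure lebesgue (ball Y \<delta>)"
      using \<delta>(1) K unfolding dim_def by (simp add: content_ball power_mult_distrib)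
    finally show False by simp
  qed
  moreover have "countable {F::(int^'n) set. finite F}" by (rule countable_Collect_finite)
  ultimately have "negligible (\<Union>(D ` {F. finite F}))"
    by (intro negligible_countable_Union) auto
  moreover have "W - limsup_set \<Phi> \<Psi> Q \<subseteq> \<Union>(D ` {F. finite F})"
  proof
    fix X assume X: "X \<in> W - limsup_set \<Phi> \<Psi> Q"
    then have "finite {q\<in>Q. X \<in> near_set \<Phi> \<Psi> q}" unfolding limsup_set_def by simp
    moreover have "X \<in> D {q\<in>Q. X \<in> near_set \<Phi> \<Psi> q}" using X unfolding D_def by blast
    ultimately show "X \<in> \<Union>(D ` {F. finite F})" by blast
  qed
  ultimately show ?thesis unfolding W_def using negligible_subset by blast
qed

section \<open>Zero-one law for a single class of \<open>q\<close>\<close>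

text \<open>Gaps between integers prime to a nonzero entry of \<open>q\<close> are of smaller order
  than the norm of \<open>q\<close>. So for each large \<open>q\<close> with
  \<open>\<Psi> q \<ge> e * norm (vreal q)\<close>, the window of size \<open>\<Psi> q\<close>
  contains a suitable \<open>p$j\<close> in every column.\<close>

lemma limsup_set_eq_UNIV:
  fixes \<Psi> :: "int^'n \<Rightarrow> real"
  assumes \<Phi>: "\<Phi> UNIV" and Q: "0 \<notin> Q" and e: "e > 0"
    and large: "infinite {q\<in>Q. \<Psi> q \<ge> e * norm (vreal q)}"
  shows "limsup_set \<Phi> \<Psi> Q = (UNIV :: (real^'m^'n) set)"
proof -
  have "X \<in> limsup_set \<Phi> \<Psi> Q" for X :: "real^'m^'n"
  proof -
    \<comment> \<open>\<open>N > 4 / e\<close> brings the first term of the gap bound to at most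
      half of \<open>e * norm (vreal q)\<close>; the lower bound \<open>4 * fact N / e\<close> on
      the norm handles the second term.\<close>
    obtain N :: nat where N: "4 / e < N" using reals_Archimedean2 by blast
    have N0: "real N > 0" using N e by (smt (verit) divide_pos_pos)
    have "X \<in> near_set \<Phi> \<Psi> q" if q: "q \<in> Q" "\<Psi> q \<ge> e * norm (vreal q)" "norm (vreal q) > 4 * fact N / e" for q
    proof -
      have "q \<noteq> 0" using q(1) Q by blast
      \<comment> \<open>Being prime to one nonzero entry already excludes every common prime of
        \<open>q\<close>.\<close>
      then obtain i where i: "q$i \<noteq> 0" by (auto simp: vec_eq_iff)
      have "\<forall>j. \<exists>a. coprime a (q$i) \<and> \<bar>(vreal q v* X)$j + of_int a\<bar> \<le> 2 * \<bar>q$i\<bar> / N + 2 * fact N"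
        using ex_coprime_near[OF i] N0 by simp
      then obtain a where a: "\<And>j. coprime (a j) (q$i)"
        "\<And>j. \<bar>(vreal q v* X)$j + of_int (a j)\<bar> \<le> 2 * \<bar>q$i\<bar> / N + 2 * fact N" by metis
      have "2 * real_of_int \<bar>q$i\<bar> / N \<le> 2 * norm (vreal q) / N"
        using component_le_norm_cart[of "vreal q" i] by (intro divide_right_mono) auto
      also have "\<dots> = (4 / N) * (norm (vreal q) / 2)" by simp
      also have "\<dots> \<le> e * (norm (vreal q) / 2)"
        using N e N0 by (intro mult_right_mono) (auto simp: field_simps)
      finally have 1: "2 * real_of_int \<bar>q$i\<bar> / N \<le> e * norm (vreal q) / 2" by simp
      have 2: "2 * fact N < e * norm (vreal q) / 2" using q(3) e by (simp add: field_simps)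
      have "\<bar>qXp q X (\<chi> j. a j) $ j\<bar> < \<Psi> q" for j
        using a(2)[of j] 1 2 q(2) unfolding qXp_eq by simp
      moreover have "admissible \<Phi> (\<chi> j. a j) q"
        unfolding admissible_def
      proof (intro allI impI)
        fix r :: int assume r: "prime r" "\<forall>i. r dvd q$i"
        have "\<not> r dvd a j" for j
          using a(1)[of j] r by (metis coprime_common_divisor not_prime_unit)
        then have "{j. \<not> r dvd (\<chi> j. a j) $ j} = UNIV" by simp
        then show "\<Phi> {j. \<not> r dvd (\<chi> j. a j) $ j}" using \<Phi> by metis
      qed
      ultimately show ?thesis unfolding near_set_def by blast
    qed
    then have "{q\<in>Q. \<Psi> q \<ge> e * norm (vreal q)} - {q. norm (vreal q) \<le> 4 * fact N / e}
        \<subseteq> {q\<in>Q. X \<in> near_set \<Phi> \<Psi> q}" by (auto simp: not_le)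
    moreover have "infinite ({q\<in>Q. \<Psi> q \<ge> e * norm (vreal q)} - {q. norm (vreal q) \<le> 4 * fact N / e})"
      using large finite_norm_vreal_le by (rule Diff_infinite_finite[rotated])
    ultimately show ?thesis unfolding limsup_set_def using finite_subset by blast
  qed
  then show ?thesis by blast
qed

text \<open>The map sends the set for \<open>\<Psi>\<close> into that for \<open>a * \<Psi>\<close>,
  so the union over all powers of \<open>a\<close> is mapped into itself. It exceeds the original by
  a null set when \<open>\<Psi> q / norm (vreal q)\<close> tends to 0 along \<open>Q\<close>;
  otherwise the limsup set is the whole space.\<close>

lemma limsup_set_zero_one_of_expanding:
  fixes \<Psi> :: "int^'n \<Rightarrow> real"
  assumes pos: "\<And>q. \<Psi> q > 0" and \<Phi>: "\<Phi> UNIV" and Q: "0 \<notin> Q" and a: "a > 1"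
    and step: "\<And>q p. q \<in> Q \<Longrightarrow> admissible \<Phi> p q \<Longrightarrow>
                 \<exists>p'. admissible \<Phi> p' q \<and> vreal p' = a *\<^sub>R vreal p - vreal q v* C"
  shows "negligible (limsup_set \<Phi> \<Psi> Q) \<or> negligible (- limsup_set \<Phi> \<Psi> Q :: (real^'m^'n) set)"
proof (cases "\<exists>e>0. infinite {q\<in>Q. \<Psi> q \<ge> e * norm (vreal q)}")
  case True
  then show ?thesis using limsup_set_eq_UNIV[of \<Phi>, OF \<Phi> Q, of _ \<Psi>] by force
next
  case False
  define W where "W k = (limsup_set \<Phi> (\<lambda>q. a ^ k * \<Psi> q) Q :: (real^'m^'n) set)" for k :: nat
  define U where "U = (\<Union>k. W k)"
  have "U \<in> sets lebesgue"
    unfolding U_def W_def by (intro sets.countable_UN) (auto intro: limsup_set_measurable)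
  moreover have "a *\<^sub>R X + C \<in> U" if X: "X \<in> U" for X
  proof -
    obtain k where "X \<in> W k" using X unfolding U_def by blast
    then have "a *\<^sub>R X + C \<in> W (Suc k)"
      using limsup_set_affine[where a = a and \<Phi> = \<Phi> and C = C and X = X and \<Psi> = "\<lambda>q. a ^ k * \<Psi> q", OF _ step] a
      unfolding W_def by (simp add: mult.assoc)
    then show ?thesis unfolding U_def by blast
  qed
  moreover have "X \<in> U \<longleftrightarrow> X + Z \<in> U" if Z: "Z \<in> range mreal" for X Z
  proof -
    obtain E where E: "Z = mreal E" using Z by blast
    \<comment> \<open>Periodicity is an implication for each \<open>E\<close>; using it for
      \<open>- E\<close> as well gives the equivalence.\<close>
    have "mreal (- E) = - mreal E" by (simp add: vec_eq_iff)
    then have "X + Z + mreal (- E) = X" using E by simp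
    then show ?thesis
      unfolding U_def W_def E using limsup_set_periodic[of _ \<Phi> _ Q] by (metis (no_types, lifting) E UN_iff)
  qed
  moreover have "\<exists>Z\<in>range mreal. dist X Z \<le> CARD('n) * CARD('m)" for X :: "real^'m^'n"
    using ex_mreal_near by blast
  ultimately have "negligible U \<or> negligible (- U)"
    by (rule negligible_or_compl_of_expanding[OF _ a])
  moreover have "negligible (U - W 0)"
  proof -
    have "negligible (W k - W 0)" for k
      using limsup_set_scale_negligible[of \<Psi> "a ^ k" Q \<Phi>, OF pos _ Q] False a
      unfolding W_def by simp
    then have "negligible (\<Union>k. W k - W 0)" by (intro negligible_countable_Union) auto
    moreover have "U - W 0 = (\<Union>k. W k - W 0)" unfolding U_def by blast
    ultimately show ?thesis by simp
  qed
  moreover have "W 0 \<subseteq> U" "- W 0 \<subseteq> - U \<union> (U - W 0)" unfolding U_def by auto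
  ultimately have "negligible (W 0) \<or> negligible (- W 0)"
    by (meson negligible_Un negligible_subset)
  then show ?thesis unfolding W_def by simp
qed

section \<open>The three divisibility classes for a prime \<open>l\<close>\<close>

lemma limsup_set_nondivisible_zero_one:
  fixes \<Psi> :: "int^'n \<Rightarrow> real"
  assumes pos: "\<And>q. \<Psi> q > 0" and \<Phi>: "\<Phi> UNIV" and l: "prime (l::int)"
    and Q: "\<And>q. q \<in> Q \<Longrightarrow> \<exists>i. \<not> l dvd q$i"
  shows "negligible (limsup_set \<Phi> \<Psi> Q) \<or> negligible (- limsup_set \<Phi> \<Psi> Q :: (real^'m^'n) set)"
proof (rule limsup_set_zero_one_of_expanding[of \<Psi> \<Phi>, OF pos \<Phi>, where a = "of_int l" and C = 0])
  show "0 \<notin> Q" using Q by fastforce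
  show "real_of_int l > 1" using prime_gt_1_int[OF l] by simp
  fix q p assume "q \<in> Q" and p: "admissible \<Phi> p q"
  then obtain i where "\<not> l dvd q$i" using Q by blast
  from admissible_scale[OF l this p]
  show "\<exists>p'. admissible \<Phi> p' q \<and> vreal p' = of_int l *\<^sub>R vreal p - vreal q v* (0::real^'m^'n)"
    by (intro exI[of _ "\<chi> j. l * p$j"]) (simp add: vec_eq_iff vector_matrix_mult_nth)
qed

text \<open>Row \<open>k\<close> of \<open>C\<close> is constantly \<open>1 / l\<close>, so every
  entry of \<open>qC\<close> is \<open>c = q$k / l\<close>, an integer not divisible by
  \<open>l\<close>. The index \<open>k\<close> is common to the class because \<open>C\<close> must
  not vary with \<open>q\<close>.\<close>

lemma limsup_set_exactly_divisible_zero_one: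
  fixes \<Psi> :: "int^'n \<Rightarrow> real"
  assumes pos: "\<And>q. \<Psi> q > 0" and \<Phi>: "\<Phi> UNIV" and l: "prime (l::int)"
    and Q: "\<And>q. q \<in> Q \<Longrightarrow> l dvd q$k \<and> \<not> l\<^sup>2 dvd q$k"
  shows "negligible (limsup_set \<Phi> \<Psi> Q) \<or> negligible (- limsup_set \<Phi> \<Psi> Q :: (real^'m^'n) set)"
proof (rule limsup_set_zero_one_of_expanding[of \<Psi> \<Phi>, OF pos \<Phi>, where a = "of_int l" and C = "\<chi> i j. if i = k then 1 / of_int l else 0"])
  show "0 \<notin> Q" using Q by fastforce
  show "real_of_int l > 1" using prime_gt_1_int[OF l] by simp
  then have l0: "real_of_int l \<noteq> 0" by linarith
  fix q p assume "q \<in> Q" and p: "admissible \<Phi> p q"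
  then obtain c where c: "q$k = l * c" using Q by blast
  have "\<not> l dvd c" using Q[OF \<open>q \<in> Q\<close>] unfolding c power2_eq_square by (auto intro: mult_dvd_mono)
  from admissible_scale_shift[OF \<Phi> l c this p]
  show "\<exists>p'. admissible \<Phi> p' q \<and> vreal p' = of_int l *\<^sub>R vreal p
      - vreal q v* (\<chi> i j. if i = k then 1 / of_int l else 0 :: real^'m^'n)"
    using c l0 by (intro exI[of _ "\<chi> j. l * p$j - c"])
      (simp add: vec_eq_iff vector_matrix_mult_nth if_distrib[of "\<lambda>x. x * _"] cong: if_cong)
qed

text \<open>Here \<open>q / l\<close> is an integer vector whose entries are still divisible by
  every common prime of \<open>q\<close>, including \<open>l\<close>; so \<open>p\<close> changes
  only by multiples of these primes.\<close>

lemma limsup_set_square_divisible_translate: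
  fixes X :: "real^'m^'n"
  assumes l: "prime (l::int)" and Q: "\<And>q i. q \<in> Q \<Longrightarrow> l\<^sup>2 dvd q$i"
    and X: "X \<in> limsup_set \<Phi> \<Psi> Q"
  shows "X + (1 / of_int l) *\<^sub>R mreal E \<in> limsup_set \<Phi> \<Psi> Q"
proof -
  have l0: "l \<noteq> 0" using prime_gt_1_int[OF l] by simp
  have "\<exists>p'. admissible \<Phi> p' q \<and> vreal p' = 1 *\<^sub>R vreal p - vreal q v* ((1 / of_int l) *\<^sub>R mreal E)"
    if q: "q \<in> Q" and p: "admissible \<Phi> p q" for p q
  proof -
    have "\<forall>i. \<exists>c. q$i = l * (l * c)" using Q[OF q] by (metis dvdE mult.assoc power2_eq_square)
    then obtain c where c: "\<And>i. q$i = l * (l * c i)" by metis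
    let ?v = "\<chi> j. - (\<Sum>i\<in>UNIV. E$i$j * (l * c i))"
    have "admissible \<Phi> (p + ?v) q"
    proof (rule admissible_add[OF p])
      fix r j assume r: "prime r" "\<forall>i. r dvd q$i"
      have "r dvd l * c i" for i
      proof -
        have "r dvd l \<or> r dvd l * c i" using r c prime_dvd_mult_iff by metis
        then show ?thesis by auto
      qed
      then show "r dvd ?v $ j" by (auto intro!: dvd_sum)
    qed
    moreover have "vreal (p + ?v) = 1 *\<^sub>R vreal p - vreal q v* ((1 / of_int l) *\<^sub>R mreal E)"
      using l0 c by (simp add: vec_eq_iff vector_matrix_mult_nth)
    ultimately show ?thesis by blast
  qed
  from limsup_set_affine[of 1, OF _ this X] show ?thesis by simp
qed

section \<open>Combination of the classes over all primes\<close>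

lemma limsup_set_zero_one:
  fixes \<Psi> :: "int^'n \<Rightarrow> real"
  assumes pos: "\<And>q. \<Psi> q > 0" and \<Phi>: "\<Phi> UNIV"
  shows "negligible (limsup_set \<Phi> \<Psi> (- {0})) \<or> negligible (- limsup_set \<Phi> \<Psi> (- {0}) :: (real^'m^'n) set)"
proof (rule disjCI)
  define W where "W = (limsup_set \<Phi> \<Psi> (- {0}) :: (real^'m^'n) set)"
  define T where "T = {(1 / of_int l) *\<^sub>R mreal E | l (E :: int^'m^'n). prime (l::int)}"
  assume "\<not> negligible (- limsup_set \<Phi> \<Psi> (- {0}) :: (real^'m^'n) set)"
  then have nW: "\<not> negligible (- W)" unfolding W_def .
  \<comment> \<open>A subset of \<open>W\<close> cannot be co-null because \<open>W\<close> is not,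
    so its own zero-one law leaves only the null case.\<close>
  have part: "negligible (limsup_set \<Phi> \<Psi> Q)"
    if "Q \<subseteq> - {0}" "negligible (limsup_set \<Phi> \<Psi> Q) \<or> negligible (- limsup_set \<Phi> \<Psi> Q :: (real^'m^'n) set)" for Q
    using that nW limsup_set_mono[OF that(1)] unfolding W_def
    by (meson Compl_subset_Compl_iff negligible_subset)
  have "negligible ((+) t ` W - W)" if tT: "t \<in> T" for t
  proof -
    obtain l :: int and E :: "int^'m^'n" where l: "prime l" and t: "t = (1 / of_int l) *\<^sub>R mreal E"
      using tT unfolding T_def by blast
    define Q0 where "Q0 = {q::int^'n. \<exists>i. \<not> l dvd q$i}"
    define Q1 where "Q1 k = {q::int^'n. l dvd q$k \<and> \<not> l\<^sup>2 dvd q$k}" for k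
    define Q2 where "Q2 = {q::int^'n. q \<noteq> 0 \<and> (\<forall>i. l\<^sup>2 dvd q$i)}"
    have neg0: "negligible (limsup_set \<Phi> \<Psi> Q0 :: (real^'m^'n) set)"
      by (rule part, force simp: Q0_def)
        (rule limsup_set_nondivisible_zero_one[of \<Psi> \<Phi>, OF pos \<Phi> l], simp add: Q0_def)
    have neg1: "negligible (limsup_set \<Phi> \<Psi> (Q1 k) :: (real^'m^'n) set)" for k
      by (rule part, force simp: Q1_def)
        (rule limsup_set_exactly_divisible_zero_one[of \<Psi> \<Phi>, OF pos \<Phi> l], simp add: Q1_def)
    define N where "N = (limsup_set \<Phi> \<Psi> Q0 \<union> (\<Union>k. limsup_set \<Phi> \<Psi> (Q1 k)) :: (real^'m^'n) set)"
    define W2 where "W2 = (limsup_set \<Phi> \<Psi> Q2 :: (real^'m^'n) set)"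
    have "negligible N" unfolding N_def using neg0 neg1 by (intro negligible_Un negligible_Union) auto
    then have negN: "negligible ((+) t ` N)" by (rule negligible_translation)
    have "- {0} \<subseteq> Q0 \<union> (\<Union>k. Q1 k) \<union> Q2"
      unfolding Q0_def Q1_def Q2_def by blast
    then have "W \<subseteq> N \<union> W2"
      unfolding W_def N_def W2_def using limsup_set_mono[of "- {0}" _ \<Phi> \<Psi>]
      by (metis finite_class.finite_UNIV limsup_set_UN limsup_set_Un)
    moreover have "(+) t ` W2 \<subseteq> W2"
      unfolding W2_def t using limsup_set_square_divisible_translate[OF l, of Q2 _ \<Phi> \<Psi> E]
      by (auto simp: Q2_def add.commute)
    moreover have "W2 \<subseteq> W" unfolding W_def W2_def by (rule limsup_set_mono) (auto simp: Q2_def)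
    \<comment> \<open>Outside \<open>N\<close>, a point of \<open>W\<close> lies in
      \<open>W2\<close>, which \<open>t\<close> carries into itself and hence into
      \<open>W\<close>.\<close>
    ultimately have "(+) t ` W - W \<subseteq> (+) t ` N" by blast
    with negN show ?thesis by (rule negligible_subset)
  qed
  moreover have "\<exists>t\<in>T. dist X t < e" if e: "e > 0" for X e
  proof -
    define B where "B = real (CARD('n) * CARD('m))"
    obtain m :: nat where m: "B / e < m" using reals_Archimedean2 by blast
    \<comment> \<open>A prime above \<open>B / e\<close> makes the net of integer matrices over
      \<open>l\<close> finer than \<open>e\<close>.\<close>
    obtain l where l: "prime l" "l > m" using bigger_prime by blast
    have l0: "real l > 0" using l by simp
    have "B / e < l" using m l(2) by linarith
    then have Bl: "B / l < e" using e l0 by (simp add: field_simps)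
    obtain E :: "int^'m^'n" where E: "dist (real l *\<^sub>R X) (mreal E) \<le> B"
      using ex_mreal_near[of "real l *\<^sub>R X"] unfolding B_def by blast
    have "real l * dist X ((1 / real l) *\<^sub>R mreal E) = dist (real l *\<^sub>R X) (mreal E)"
      using l0 norm_scaleR[of "real l" "X - (1 / real l) *\<^sub>R mreal E"]
      by (simp add: dist_norm scaleR_diff_right)
    then have "dist X ((1 / real l) *\<^sub>R mreal E) \<le> B / l" using E l0 by (simp add: field_simps)
    then have "dist X ((1 / of_int (int l)) *\<^sub>R mreal E) < e" using Bl by simp
    moreover have "(1 / of_int (int l)) *\<^sub>R mreal E \<in> T" unfolding T_def using l(1) by (auto simp del: of_int_of_nat_eq)
    ultimately show ?thesis by blast
  qed
  moreover have "W \<in> sets lebesgue" unfolding W_def by (rule limsup_set_measurable)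
  ultimately show "negligible (limsup_set \<Phi> \<Psi> (- {0}) :: (real^'m^'n) set)"
    using negligible_or_compl_of_dense_translations[of W T] nW unfolding W_def by blast
qed

section \<open>Return to pairs \<open>(p, q)\<close> and to the unit cube\<close>

text \<open>For fixed \<open>q\<close> the inequality confines \<open>p\<close> to a bounded box, so
  there are infinitely many pairs exactly when infinitely many \<open>q\<close> occur in
  them.\<close>

lemma infinite_approx_iff:
  fixes X :: "real^'m^'n"
  shows "infinite {(p, q). approx_ineq \<Psi> X p q \<and> admissible \<Phi> p q} \<longleftrightarrow> X \<in> limsup_set \<Phi> \<Psi> (- {0})"
proof -
  define S where "S = {(p, q). approx_ineq \<Psi> X p q \<and> admissible \<Phi> p q}"
  have snd_S: "snd ` S = {q\<in>- {0}. X \<in> near_set \<Phi> \<Psi> q}"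
    unfolding S_def near_set_def approx_ineq_def by force
  have fin: "finite (S \<inter> snd -` {q})" for q
  proof -
    define B where "B = norm (vreal q v* X) + \<Psi> q"
    have "S \<inter> snd -` {q} \<subseteq> {p. \<forall>j. \<bar>real_of_int (p$j)\<bar> \<le> B} \<times> {q}"
    proof clarsimp
      fix p j assume "(p, q) \<in> S"
      then have "\<bar>(vreal q v* X) $ j + p$j\<bar> < \<Psi> q"
        unfolding S_def approx_ineq_def qXp_eq by simp
      then show "\<bar>real_of_int (p$j)\<bar> \<le> B"
        using component_le_norm_cart[of "vreal q v* X" j] unfolding B_def by linarith
    qed
    then show ?thesis
      by (rule finite_subset) (simp add: finite_int_vec_bounded)
  qed
  have "S = (\<Union>q\<in>snd ` S. S \<inter> snd -` {q})" by auto
  then have "finite S \<longleftrightarrow> finite (snd ` S)" using fin by (metis finite_UN_I finite_imageI)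
  then have "finite S \<longleftrightarrow> finite {q\<in>- {0}. X \<in> near_set \<Phi> \<Psi> q}" unfolding snd_S .
  then show ?thesis unfolding S_def limsup_set_def by simp
qed

lemma unit_cube_eq_cbox: "(unit_cube :: (real^'m^'n) set) = cbox 0 (\<chi> i j. 1)"
  by (auto simp: unit_cube_def cbox_def Basis_vec_def inner_axis)

lemma emeasure_unit_cube: "emeasure lebesgue (unit_cube :: (real^'m^'n) set) = 1"
proof -
  have "\<forall>b\<in>Basis. (\<chi> i j. 1 :: real^'m^'n) \<bullet> b = 1"
    by (auto simp: Basis_vec_def inner_axis)
  then show ?thesis unfolding unit_cube_eq_cbox
    by (simp add: emeasure_lborel_cbox_eq)
qed

lemma zero_one_law_cube_Int_limsup_set:
  fixes \<Psi> :: "int^'n \<Rightarrow> real"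
  assumes "\<And>q. \<Psi> q > 0" "\<Phi> UNIV"
  shows "zero_one_law (unit_cube \<inter> limsup_set \<Phi> \<Psi> (- {0}) :: (real^'m^'n) set)"
proof -
  define W where "W = (limsup_set \<Phi> \<Psi> (- {0}) :: (real^'m^'n) set)"
  have cube: "(unit_cube :: (real^'m^'n) set) \<in> sets lebesgue" unfolding unit_cube_eq_cbox by simp
  have W: "W \<in> sets lebesgue" unfolding W_def by (rule limsup_set_measurable)
  have "negligible W \<or> negligible (- W)" unfolding W_def by (rule limsup_set_zero_one[of \<Psi> \<Phi>, OF assms])
  then have "emeasure lebesgue (unit_cube \<inter> W) = 0 \<or> emeasure lebesgue (unit_cube \<inter> W) = 1"
  proof
    assume "negligible W"
    then have "negligible (unit_cube \<inter> W)" by (rule negligible_subset) blast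
    then show ?thesis by (simp add: negligible_iff_null_sets null_sets_def)
  next
    assume "negligible (- W)"
    then have "- W \<in> null_sets lebesgue" by (simp add: negligible_iff_null_sets)
    then have "emeasure lebesgue (unit_cube - - W) = emeasure lebesgue (unit_cube :: (real^'m^'n) set)"
      using cube by (rule emeasure_Diff_null_set)
    then show ?thesis by (simp add: emeasure_unit_cube Diff_eq)
  qed
  then show ?thesis using cube W unfolding zero_one_law_def W_def by auto
qed

theorem theorem1:
  fixes \<Psi> :: "int^'n \<Rightarrow> real"
  assumes "\<forall>q. \<Psi> q > 0"
  shows "zero_one_law (A_set \<Psi> :: (real^'m^'n) set)
       \<and> zero_one_law (A'_set \<Psi> :: (real^'m^'n) set)
       \<and> zero_one_law (A''_set \<Psi> :: (real^'m^'n) set)"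
proof -
  have "A_set \<Psi> = (unit_cube \<inter> limsup_set (\<lambda>_. True) \<Psi> (- {0}) :: (real^'m^'n) set)"
    by (rule set_eqI) (simp add: A_set_def admissible_def flip: infinite_approx_iff)
  moreover have "A'_set \<Psi> = (unit_cube \<inter> limsup_set (\<lambda>J. J \<noteq> {}) \<Psi> (- {0}) :: (real^'m^'n) set)"
    by (rule set_eqI) (simp add: A'_set_def admissible_nonempty_iff flip: infinite_approx_iff)
  moreover have "A''_set \<Psi> = (unit_cube \<inter> limsup_set (\<lambda>J. J = UNIV) \<Psi> (- {0}) :: (real^'m^'n) set)"
    by (rule set_eqI) (simp add: A''_set_def admissible_UNIV_iff flip: infinite_approx_iff)
  ultimately show ?thesis using assms by (simp add: zero_one_law_cube_Int_limsup_set)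
qed

end
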